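(* Let $A_1,A_2,\dots,A_l$ be a commuting family of matrices in $M_{n\times n}(\mathbb{C})$. Let $\mathcal{F}$ be the algebra of matrices in $M_{n\times n}(\mathbb{C})$ generated by $A_1,A_2,\dots,A_l$ and the identity. Then $$\dim_{\mathbb{C}}\mathcal{F}\le (l+1)\,n^{2-\frac{2}{l+1}}.$$
   Context: $M_{n\times n}(\mathbb{C})$ denotes the algebra of $n\times n$ complex matrices; $\mathcal{F}$ is the $\mathbb{C}$-subalgebra generated by the given matrices and the identity. *)

theory Defs
  imports "HOL-Analysis.Analysis"
begin

definition scale_mat :: "complex \<Rightarrow> complex^'n^'n \<Rightarrow> complex^'n^'n"
  where "scale_mat c M = (\<chi> i j. c * M $ i $ j)"

definition mat_unit :: "'n \<Rightarrow> 'n \<Rightarrow> complex^'n^'n"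
  where "mat_unit p q = (\<chi> i j. if i = p \<and> j = q then 1 else 0)"

definition mat_units :: "(complex^'n^'n) set"
  where "mat_units = range (\<lambda>(p, q). mat_unit p q)"

(* The complex structure on matrices; the dimension from class euclidean_space,
   written dim without qualifier, is the dimension over the reals. *)
interpretation cmat: vector_space "scale_mat :: complex \<Rightarrow> complex^'n^'n \<Rightarrow> complex^'n^'n"
  by unfold_locales (simp_all add: scale_mat_def vec_eq_iff algebra_simps)

lemma inj_mat_unit: "inj (\<lambda>(p :: 'n::finite, q :: 'n). mat_unit p q)"
proof (rule injI, clarify)
  fix p q p' q' :: "'n::finite"
  assume "mat_unit p q = mat_unit p' q'"
  then have "mat_unit p q $ p $ q = mat_unit p' q' $ p $ q" by simp
  then show "p = p' \<and> q = q'" by (simp add: mat_unit_def split: if_splits)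
qed

lemma finite_mat_units: "finite mat_units"
  by (simp add: mat_units_def)

lemma sum_mat_units:
  "(\<Sum>x\<in>UNIV. scale_mat (f x) (case x of (p, q) \<Rightarrow> mat_unit p q)) $ i $ j = f (i, j)"
proof -
  have "(\<Sum>x\<in>UNIV. scale_mat (f x) (case x of (p, q) \<Rightarrow> mat_unit p q)) $ i $ j
      = (\<Sum>x\<in>UNIV. if x = (i, j) then f x else 0)"
    unfolding sum_component
    by (rule sum.cong) (auto simp: scale_mat_def mat_unit_def split: prod.splits)
  then show ?thesis by simp
qed

lemma independent_mat_units: "cmat.independent (mat_units :: (complex^'n^'n) set)"
proof (rule cmat.independent_if_scalars_zero[OF finite_mat_units])
  fix f :: "complex^'n^'n \<Rightarrow> complex" and x :: "complex^'n^'n"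
  assume 0: "(\<Sum>x\<in>mat_units. scale_mat (f x) x) = 0" and "x \<in> mat_units"
  then obtain p q where x: "x = mat_unit p q" by (auto simp: mat_units_def)
  define g where "g y = f (case y of (p, q) \<Rightarrow> mat_unit p q)" for y :: "'n \<times> 'n"
  have "(\<Sum>y\<in>UNIV. scale_mat (g y) (case y of (p, q) \<Rightarrow> mat_unit p q)) = 0"
    using 0 unfolding mat_units_def g_def by (simp add: sum.reindex[OF inj_mat_unit] o_def)
  then have "g (p, q) = 0" using sum_mat_units[of g p q] by simp
  then show "f x = 0" by (simp add: g_def x)
qed

lemma span_mat_units: "cmat.span mat_units = UNIV"
proof (intro set_eqI iffI UNIV_I)
  fix M :: "complex^'n^'n"
  have "M = (\<Sum>x\<in>UNIV. scale_mat (case x of (p, q) \<Rightarrow> M $ p $ q) (case x of (p, q) \<Rightarrow> mat_unit p q))"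
    by (simp only: vec_eq_iff sum_mat_units) simp
  also have "\<dots> \<in> cmat.span mat_units"
    by (intro cmat.span_sum cmat.span_scale cmat.span_base) (auto simp: mat_units_def)
  finally show "M \<in> cmat.span mat_units" .
qed

interpretation cmat: finite_dimensional_vector_space
  "scale_mat :: complex \<Rightarrow> complex^'n^'n \<Rightarrow> complex^'n^'n" mat_units
  by unfold_locales (rule finite_mat_units independent_mat_units span_mat_units)+

definition is_subalgebra :: "(complex^'n^'n) set \<Rightarrow> bool"
  where "is_subalgebra S \<longleftrightarrow> cmat.subspace S \<and> (\<forall>M\<in>S. \<forall>N\<in>S. M ** N \<in> S)"

definition generated_algebra :: "(complex^'n^'n) set \<Rightarrow> (complex^'n^'n) set"
  where "generated_algebra G = is_subalgebra hull G"

end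

theory Submission
  imports Defs "HOL-Computational_Algebra.Fundamental_Theorem_Algebra"
begin

text \<open>
  Write \<open>n = CARD('n)\<close>. For each \<open>i\<close> choose shifts greedily: \<open>Q i (a + 1) = (A i - \<mu>) Q i a\<close>, where
  \<open>\<mu>\<close> maximises the dimension of the eigenspace of \<open>A i\<close> inside the range of \<open>Q i a\<close>. These maxima
  decrease with \<open>a\<close> and each is the drop in rank at its step, so every eigenspace of \<open>A i\<close> inside
  the range \<open>W\<close> of \<open>Q i k\<close> has dimension at most \<open>s = n / (k + 1)\<close>. Filtering \<open>W\<close> by the images of
  further shifts shows that the matrices commuting with \<open>A i\<close> act on \<open>W\<close> through a space of dimension
  at most \<open>s dim W\<close>; hence the ideal \<open>Q i k F\<close> has dimension at most \<open>n\<^sup>2 / (k + 1)\<close>.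
  Modulo these \<open>l\<close> ideals, \<open>F\<close> is spanned by the \<open>k ^ l\<close> products of the \<open>Q i a\<close> with \<open>a < k\<close>. So
  \<open>dim F \<le> k ^ l + l n\<^sup>2 / (k + 1)\<close>, and one takes \<open>k = \<lfloor>n powr (2 / (l + 1))\<rfloor>\<close>.
\<close>

section \<open>Rank-nullity on a subspace, and matrix arithmetic\<close>

text \<open>A basis \<open>B\<close> of the kernel inside \<open>S\<close> is extended to a basis
  \<open>C\<close> of \<open>S\<close>. The span of \<open>C - B\<close> meets the kernel only in 0,
  so \<open>f\<close> is injective there, and it has the same image as \<open>S\<close>.\<close>

lemma (in finite_dimensional_vector_space_pair_1) dim_image_plus_dim_kernel:
  assumes f: "Vector_Spaces.linear s1 s2 f" and S: "vs1.subspace S"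
  shows "vs2.dim (f ` S) + vs1.dim {x \<in> S. f x = 0} = vs1.dim S"
proof -
  interpret lf: Vector_Spaces.linear s1 s2 f by (rule f)
  let ?K = "{x \<in> S. f x = 0}"
  have K: "vs1.subspace ?K"
    using S by (auto simp: vs1.subspace_def lf.add lf.scale)
  obtain B where B: "B \<subseteq> ?K" "vs1.independent B" "?K \<subseteq> vs1.span B" "card B = vs1.dim ?K"
    using vs1.basis_exists by blast
  obtain C where C: "B \<subseteq> C" "C \<subseteq> S" "vs1.independent C" "S \<subseteq> vs1.span C"
    using vs1.maximal_independent_subset_extend[of B S] B by blast
  have fin: "finite C" "finite B" using C B vs1.finiteI_independent by blast+
  have cardC: "card C = vs1.dim S" using C vs1.basis_card_eq_dim by blast
  have spanB: "vs1.span B = ?K" using B K vs1.span_subspace by blast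
  let ?D = "C - B"
  have D: "vs1.independent ?D" using C(3) vs1.independent_mono by blast
  have spanD: "vs1.span ?D \<subseteq> S"
    using C S by (metis Diff_subset order_trans vs1.span_minimal)
  have "C = ?D \<union> B" using C by blast
  then have sum: "S = {x + y | x y. x \<in> vs1.span ?D \<and> y \<in> ?K}"
    using C S vs1.span_subspace[of C S] vs1.span_Un[of ?D B] spanB by simp
  have "card ?D + card B = card C"
    using C(1) fin by (simp add: card_Diff_subset card_mono)
  then have "vs1.dim (vs1.span ?D \<inter> ?K) = 0"
    using vs1.dim_sums_Int[OF vs1.subspace_span K, of ?D, folded sum] cardC B(4)
      vs1.dim_span_eq_card_independent[OF D]
    by linarith
  then have "vs1.span ?D \<inter> ?K \<subseteq> {0}"
    by (simp only: vs1.dim_eq_0)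
  then have inj: "inj_on f (vs1.span ?D)"
    using lf.inj_on_iff_eq_0[OF vs1.subspace_span] spanD by auto
  have "f ` S \<subseteq> f ` vs1.span ?D"
  proof
    fix z assume "z \<in> f ` S"
    then obtain s where "s \<in> S" "z = f s" by blast
    moreover from \<open>s \<in> S\<close> obtain x y where "x \<in> vs1.span ?D" "f y = 0" "s = x + y"
      by (subst (asm) sum) blast
    ultimately have "z = f x" by (simp only: lf.add add_0_right)
    with \<open>x \<in> vs1.span ?D\<close> show "z \<in> f ` vs1.span ?D" by blast
  qed
  then have "f ` S = f ` vs1.span ?D" using spanD by blast
  then have "vs2.dim (f ` S) = card ?D"
    using dim_image_eq[OF f, of "vs1.span ?D"] inj vs1.dim_span_eq_card_independent[OF D]
    by (simp only: vs1.span_span)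
  then show ?thesis
    using \<open>card ?D + card B = card C\<close> cardC B(4) by linarith
qed

lemma scale_mat_mult_left: "scale_mat c M ** N = scale_mat c (M ** N)"
  by (simp add: scale_mat_def matrix_matrix_mult_def vec_eq_iff sum_distrib_left mult.assoc)

lemma scale_mat_mult_right: "M ** scale_mat c N = scale_mat c (M ** N)"
  by (simp add: scale_mat_def matrix_matrix_mult_def vec_eq_iff sum_distrib_left mult_ac)

lemma scale_mat_mult_vec: "scale_mat c M *v x = c *s (M *v x)"
  by (simp add: scale_mat_def matrix_vector_mult_def vec_eq_iff sum_distrib_left mult_ac)

lemma mat_eq_scale_mat: "mat c = scale_mat c (mat 1)"
  by (simp add: scale_mat_def mat_def vec_eq_iff)

lemma linear_matrix_mult: "Vector_Spaces.linear scale_mat scale_mat ((**) (M :: complex^'n^'n))"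
  by unfold_locales (simp_all add: matrix_add_ldistrib scale_mat_mult_right)

lemma linear_matrix_eval:
  "Vector_Spaces.linear scale_mat (*s) (\<lambda>M :: complex^'n^'n. M *v x)"
  by unfold_locales (simp_all add: matrix_vector_mult_add_rdistrib scale_mat_mult_vec)

interpretation cmat_vec: finite_dimensional_vector_space_pair_1
  "scale_mat :: complex \<Rightarrow> complex^'n^'n \<Rightarrow> complex^'n^'n" mat_units
  "(*s) :: complex \<Rightarrow> complex^'n \<Rightarrow> complex^'n" ..

interpretation cmat_pair: finite_dimensional_vector_space_pair_1
  "scale_mat :: complex \<Rightarrow> complex^'n^'n \<Rightarrow> complex^'n^'n" mat_units
  "scale_mat :: complex \<Rightarrow> complex^'n^'n \<Rightarrow> complex^'n^'n" ..

section \<open>Eigenspaces inside a subspace\<close>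

abbreviation eigenspace_in :: "complex^'n^'n \<Rightarrow> complex \<Rightarrow> (complex^'n) set \<Rightarrow> (complex^'n) set"
  where "eigenspace_in A \<mu> W \<equiv> {w \<in> W. (A - mat \<mu>) *v w = 0}"

lemma shift_mult_vec: "(A - mat \<mu>) *v w = A *v w - \<mu> *s w" for A :: "complex^'n^'n"
  by (subst mat_eq_scale_mat) (simp add: matrix_vector_mult_diff_rdistrib scale_mat_mult_vec)

lemma matrix_commute_mult:
  fixes g M N :: "complex^'n^'n"
  assumes "g ** M = M ** g" "g ** N = N ** g"
  shows "g ** (M ** N) = (M ** N) ** g"
proof -
  have "g ** (M ** N) = M ** g ** N" by (simp add: matrix_mul_assoc assms(1))
  also have "\<dots> = (M ** N) ** g" by (simp add: assms(2) flip: matrix_mul_assoc)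
  finally show ?thesis .
qed

lemma matrix_add_rdistrib: "(A + B) ** M = A ** M + B ** M" for A B M :: "complex^'n^'n"
  by (simp add: matrix_matrix_mult_def vec_eq_iff sum.distrib distrib_right)

lemma matrix_diff_rdistrib: "(A - B) ** M = A ** M - B ** M" for A B M :: "complex^'n^'n"
  by (simp add: matrix_matrix_mult_def vec_eq_iff sum_subtractf left_diff_distrib)

lemma matrix_diff_ldistrib: "M ** (A - B) = M ** A - M ** B" for A B M :: "complex^'n^'n"
  by (simp add: matrix_matrix_mult_def vec_eq_iff sum_subtractf right_diff_distrib)

lemma shift_mult: "(A - mat \<mu>) ** M = A ** M - scale_mat \<mu> M" 
  "M ** (A - mat \<mu>) = M ** A - scale_mat \<mu> M" for A M :: "complex^'n^'n"
  by (subst mat_eq_scale_mat, simp add: matrix_diff_ldistrib matrix_diff_rdistrib scale_mat_mult_left scale_mat_mult_right)+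

lemma dim_eigenspace_plus_dim_shift:
  assumes "vec.subspace W"
  shows "vec.dim ((*v) (A - mat \<mu>) ` W) + vec.dim (eigenspace_in A \<mu> W) = vec.dim W"
  using vec.dim_image_plus_dim_kernel[OF matrix_vector_mul_linear_gen assms] by simp

text \<open>Among the nonzero polynomials \<open>p\<close> with \<open>p(A) v = 0\<close> take one
  of least degree. It has a root \<mu>, and for its cofactor \<open>q\<close> the vector
  \<open>q(A) v\<close> is nonzero by minimality and is killed by
  \<open>A - mat \<mu>\<close>.\<close>

lemma eigenvector_exists:
  fixes A :: "complex^'n^'n"
  assumes W: "vec.subspace W" and inv: "\<And>w. w \<in> W \<Longrightarrow> A *v w \<in> W" and "W \<noteq> {0}"
  obtains \<mu> v where "v \<in> W" "v \<noteq> 0" "(A - mat \<mu>) *v v = 0"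
proof -
  obtain v where v: "v \<in> W" "v \<noteq> 0"
    using W \<open>W \<noteq> {0}\<close> vec.subspace_0 by blast
  \<comment> \<open>\<open>E p\<close> is \<open>p(A) v\<close>, evaluated by Horner's
    scheme.\<close>
  define E where "E p = fold_coeffs (\<lambda>a x. a *s v + A *v x) p 0" for p
  have E0 [simp]: "E 0 = 0" by (simp add: E_def)
  have Ec [simp]: "E (pCons a p) = a *s v + A *v E p" for a p
    by (cases "a = 0 \<and> p = 0") (auto simp: E_def)
  have Eadd: "E (p + q) = E p + E q" for p q
    by (induction p q rule: poly_induct2)
      (simp_all add: vec.scale_left_distrib matrix_vector_right_distrib)
  have Esmult: "E (smult c p) = c *s E p" for c p
    by (induction p) (simp_all add: vec.scale_right_distrib vec.scale)
  have EW: "E p \<in> W" for p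
    by (induction p) (auto intro: vec.subspace_0 vec.subspace_add vec.subspace_scale W inv v)
  have Eroot: "E ([:-\<mu>, 1:] * q) = (A - mat \<mu>) *v E q" for \<mu> q
    by (simp add: Eadd Esmult shift_mult_vec del: smult_minus_left)
  have "\<exists>p. p \<noteq> 0 \<and> E p = 0"
  proof -
    \<comment> \<open>The vectors \<open>A^i v\<close> for i = 0, ..., n are n + 1 in number. Linear
      dependence is a property of sets, so a repetition among them has to be treated apart; it
      yields a difference of two monomials.\<close>
    define u where "u i = E (monom 1 i)" for i
    define I where "I = {..CARD('n)}"
    show ?thesis
    proof (cases "inj_on u I")
      case False
      then obtain i j where ij: "i \<noteq> j" "u i = u j" by (auto simp: inj_on_def)
      have "E (monom 1 i + smult (-1) (monom 1 j)) = 0"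
        unfolding Eadd Esmult using ij by (simp add: u_def)
      moreover have "monom 1 i + smult (-1) (monom 1 j) \<noteq> (0 :: complex poly)"
        using ij by (simp add: poly_eq_iff) (metis)
      ultimately show ?thesis by blast
    next
      case True
      then have "card (u ` I) > vec.dim (u ` I)"
        using dim_subset_UNIV_cart_gen[of "u ` I"] by (simp add: card_image I_def)
      then have "vec.dependent (u ` I)" 
        using vec.dependent_biggerset_general[of "u ` I"] by (simp add: I_def)
      then obtain c w where c: "w \<in> u ` I" "c w \<noteq> 0" "(\<Sum>w\<in>u ` I. c w *s w) = 0"
        using vec.dependent_finite[of "u ` I"] by (auto simp: I_def)
      define p where "p = (\<Sum>i\<in>I. smult (c (u i)) (monom 1 i))"
      have Esum: "E (\<Sum>i\<in>J. f i) = (\<Sum>i\<in>J. E (f i))" if "finite J" for J :: "nat set" and f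
        using that by induction (simp_all add: Eadd)
      have "E p = 0"
        using c(3) unfolding sum.reindex[OF True] by (simp add: p_def Esum I_def Esmult flip: u_def)
      moreover obtain i where i: "i \<in> I" "w = u i" using c by blast
      have "coeff p i = c (u i)"
        using i by (simp add: p_def coeff_sum I_def if_distrib[of "(*) _"] cong: if_cong)
      then have "p \<noteq> 0" using c i by auto
      ultimately show ?thesis by blast
    qed
  qed
  then obtain p where p: "p \<noteq> 0" "E p = 0" and
    min: "\<And>q. q \<noteq> 0 \<Longrightarrow> E q = 0 \<Longrightarrow> degree p \<le> degree q"
    using ex_has_least_nat[of "\<lambda>p. p \<noteq> 0 \<and> E p = 0" _ degree] by blast
  have "degree p \<noteq> 0"
  proof
    assume "degree p = 0"
    then obtain a where "p = [:a:]" by (rule degree_eq_zeroE)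
    with p v show False by simp
  qed
  then obtain \<mu> where "poly p \<mu> = 0"
    using fundamental_theorem_of_algebra[of p] by (auto simp: constant_degree)
  then obtain q where q: "p = [:-\<mu>, 1:] * q"
    by (auto simp: poly_eq_0_iff_dvd)
  with p have "q \<noteq> 0" by auto
  then have "degree p = Suc (degree q)"
    unfolding q by (subst degree_mult_eq) auto
  then have "E q \<noteq> 0" using min[OF \<open>q \<noteq> 0\<close>] by auto
  moreover have "(A - mat \<mu>) *v E q = 0" using p(2) q Eroot by simp
  ultimately show ?thesis using that EW by blast
qed

section \<open>Spaces of matrices commuting with \<open>A\<close>\<close>

text \<open>Evaluating at the vectors of \<open>B\<close> one after another, each evaluation loses
  at most \<open>vec.dim K\<close> dimensions by rank-nullity, and its kernel is passed on to the
  next vector.\<close>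

lemma dim_le_card_mult_dim:
  fixes G :: "(complex^'n^'n) set"
  assumes "finite B" and G: "cmat.subspace G"
    and "\<And>g b. g \<in> G \<Longrightarrow> b \<in> B \<Longrightarrow> g *v b \<in> K"
  shows "cmat.dim G \<le> card B * vec.dim K + cmat.dim {g \<in> G. \<forall>b\<in>B. g *v b = 0}"
  using assms(1,3)
proof (induction B)
  case empty
  then show ?case by simp
next
  case (insert b B)
  let ?H = "{g \<in> G. \<forall>b\<in>B. g *v b = 0}"
  have H: "cmat.subspace ?H"
    using G by (auto simp: cmat.subspace_def matrix_vector_mult_add_rdistrib scale_mat_mult_vec)
  have "vec.dim ((\<lambda>g. g *v b) ` ?H) \<le> vec.dim K"
    using insert.prems by (intro vec.dim_subset) auto
  moreover have eq: "{g \<in> ?H. g *v b = 0} = {g \<in> G. \<forall>b\<in>insert b B. g *v b = 0}"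
    by auto
  ultimately have "cmat.dim ?H \<le> vec.dim K + cmat.dim {g \<in> G. \<forall>b\<in>insert b B. g *v b = 0}"
    using cmat_vec.dim_image_plus_dim_kernel[OF linear_matrix_eval H, of b]
    unfolding eq by linarith
  then show ?case
    using insert by (simp add: algebra_simps)
qed

text \<open>
  Restriction to the image \<open>(A - \<mu>) W\<close> loses only matrices killing that image. They take values in the
  eigenspace, as they commute with \<open>A\<close>, and are determined on a complement of the image, whose
  dimension is again that of the eigenspace.
\<close>
lemma dim_centralizer_le:
  fixes A :: "complex^'n^'n"
  assumes "vec.subspace W" and "\<And>w. w \<in> W \<Longrightarrow> A *v w \<in> W"
    and G: "cmat.subspace G" and comm: "\<And>g. g \<in> G \<Longrightarrow> g ** A = A ** g"
    and "\<And>g w. g \<in> G \<Longrightarrow> w \<in> W \<Longrightarrow> g *v w \<in> W"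
    and "\<And>\<mu>. vec.dim (eigenspace_in A \<mu> W) \<le> s"
  shows "cmat.dim G \<le> s * vec.dim W + cmat.dim {g \<in> G. \<forall>w\<in>W. g *v w = 0}"
  using assms(1,2,5,6)
proof (induction "vec.dim W" arbitrary: W rule: less_induct)
  case less
  note W = less.prems(1) and inv = less.prems(2) and GW = less.prems(3) and s = less.prems(4)
  show ?case
  proof (cases "W = {0}")
    case True
    then show ?thesis by simp
  next
    case False
    then obtain \<mu> v where v: "v \<in> W" "v \<noteq> 0" "(A - mat \<mu>) *v v = 0"
      using eigenvector_exists[OF W inv] by blast
    let ?N = "A - mat \<mu>"
    let ?W1 = "(*v) ?N ` W" and ?K = "eigenspace_in A \<mu> W"
    have gN: "g *v (?N *v w) = ?N *v (g *v w)" if "g ** A = A ** g" for g w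
      using that by (simp add: matrix_vector_mul_assoc shift_mult)
    have W1: "vec.subspace ?W1" using W by (rule vec.subspace_image)
    have W1W: "?W1 \<subseteq> W"
      using W inv by (auto simp: shift_mult_vec intro!: vec.subspace_diff vec.subspace_scale)
    have dims: "vec.dim ?W1 + vec.dim ?K = vec.dim W"
      by (rule dim_eigenspace_plus_dim_shift[OF W])
    \<comment> \<open>The eigenvector makes the image a proper subspace, so the induction on
      \<open>vec.dim W\<close> applies to it.\<close>
    have "vec.dim ?K > 0" using v by (auto simp: zero_less_iff_neq_zero)
    then have less: "vec.dim ?W1 < vec.dim W" using dims by linarith
    have "cmat.dim G \<le> s * vec.dim ?W1 + cmat.dim {g \<in> G. \<forall>w\<in>?W1. g *v w = 0}"
    proof (rule less.hyps[OF less W1])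
      show "A *v w \<in> ?W1" if "w \<in> ?W1" for w using that inv gN[OF refl] by auto
      show "g *v w \<in> ?W1" if "g \<in> G" "w \<in> ?W1" for g w using that GW gN[OF comm] by auto
      show "vec.dim (eigenspace_in A \<nu> ?W1) \<le> s" for \<nu>
      proof -
        have "eigenspace_in A \<nu> ?W1 \<subseteq> eigenspace_in A \<nu> W" using W1W by blast
        from vec.dim_subset[OF this] s show ?thesis by (rule order_trans)
      qed
    qed
    moreover
    let ?G1 = "{g \<in> G. \<forall>w\<in>?W1. g *v w = 0}"
    have G1: "cmat.subspace ?G1"
      using G by (auto simp: cmat.subspace_def matrix_vector_mult_add_rdistrib scale_mat_mult_vec)
    obtain B where B: "B \<subseteq> ?W1" "vec.independent B" "?W1 \<subseteq> vec.span B" "card B = vec.dim ?W1"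
      using vec.basis_exists by blast
    obtain C where C: "B \<subseteq> C" "C \<subseteq> W" "vec.independent C" "W \<subseteq> vec.span C"
      using vec.maximal_independent_subset_extend[of B W] B W1W by blast
    have fin: "finite C" "finite B" using C B vec.finiteI_independent by blast+
    have "card C = vec.dim W" using C vec.basis_card_eq_dim by blast
    then have card: "card (C - B) = vec.dim ?K"
      using dims B C fin by (simp add: card_Diff_subset)
    have "cmat.dim ?G1 \<le> card (C - B) * vec.dim ?K + cmat.dim {g \<in> ?G1. \<forall>b\<in>C - B. g *v b = 0}"
    proof (rule dim_le_card_mult_dim[OF _ G1])
      fix g b assume "g \<in> ?G1" "b \<in> C - B"
      then have "b \<in> W" "g \<in> G" "g *v (?N *v b) = 0" using C by auto
      then show "g *v b \<in> ?K" using gN[OF comm] GW by auto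
    qed (use fin in auto)
    moreover have "{g \<in> ?G1. \<forall>b\<in>C - B. g *v b = 0} \<subseteq> {g \<in> G. \<forall>w\<in>W. g *v w = 0}"
    proof (intro subsetI CollectI conjI ballI)
      fix g w assume g: "g \<in> {g \<in> ?G1. \<forall>b\<in>C - B. g *v b = 0}" and "w \<in> W"
      then have "w \<in> vec.span C" "\<forall>b\<in>C. g *v b = 0" using C B by auto
      then show "g *v w = 0" using vec.eq_0_on_span[of C g w] by blast
    qed auto
    then have "cmat.dim {g \<in> ?G1. \<forall>b\<in>C - B. g *v b = 0} \<le> cmat.dim {g \<in> G. \<forall>w\<in>W. g *v w = 0}"
      by (rule cmat.dim_subset)
    moreover have "card (C - B) * vec.dim ?K \<le> s * vec.dim ?K"
      unfolding card using s by simp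
    moreover have "s * vec.dim W = s * vec.dim ?W1 + s * vec.dim ?K"
      unfolding dims[symmetric] by (simp add: algebra_simps)
    ultimately show ?thesis by linarith
  qed
qed

section \<open>Greedy shift products and the ideals they generate\<close>

lemma greedy_shift_products:
  fixes A :: "complex^'n^'n"
  shows "\<exists>Q. Q 0 = mat 1 \<and> (\<forall>k. \<exists>\<mu>. Q (Suc k) = (A - mat \<mu>) ** Q k) \<and>
    (\<forall>k \<mu>. Suc k * vec.dim (eigenspace_in A \<mu> (range ((*v) (Q k)))) \<le> CARD('n))"
proof -
  \<comment> \<open>The invariant puts the rank beside only \<open>k\<close> copies of an eigenspace
    dimension. The missing copy is gained at the very end, since the rank itself bounds every
    eigenspace inside the range.\<close>
  define P where "P k M \<longleftrightarrow> A ** M = M ** A \<and> (k = 0 \<longrightarrow> M = mat 1) \<and>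
    (\<forall>\<mu>. vec.dim (range ((*v) M)) + k * vec.dim (eigenspace_in A \<mu> (range ((*v) M))) \<le> CARD('n))"
    for k and M :: "complex^'n^'n"
  have "\<exists>Q. \<forall>k. P k (Q k) \<and> (\<exists>\<mu>. Q (Suc k) = (A - mat \<mu>) ** Q k)"
  proof (rule dependent_nat_choice)
    show "\<exists>M. P 0 M"
      by (auto simp: P_def dim_subset_UNIV_cart_gen)
  next
    fix M k assume P: "P k M"
    define W where "W = range ((*v) M)"
    define e where "e \<mu> = vec.dim (eigenspace_in A \<mu> W)" for \<mu>
    have W: "vec.subspace W" unfolding W_def by (intro vec.subspace_image vec.subspace_UNIV)
    obtain \<mu> where \<mu>: "\<And>\<nu>. e \<nu> \<le> e \<mu>"
      using ex_has_greatest_nat[of "\<lambda>_. True" 0 e "Suc CARD('n)"]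
      by (auto simp: e_def dim_subset_UNIV_cart_gen less_Suc_eq_le)
    let ?N = "A - mat \<mu>"
    define W' where "W' = range ((*v) (?N ** M))"
    \<comment> \<open>With the shift moved to the right of \<open>M\<close>, the new range visibly
      lies inside the old one.\<close>
    have comm: "?N ** M = M ** ?N" using P by (simp add: P_def shift_mult)
    have "W' \<subseteq> W"
      unfolding W_def W'_def comm by (auto simp flip: matrix_vector_mul_assoc)
    have "W' = (*v) ?N ` W"
      unfolding W_def W'_def by (simp add: image_image matrix_vector_mul_assoc)
    then have dims: "vec.dim W' + e \<mu> = vec.dim W"
      using dim_eigenspace_plus_dim_shift[OF W] by (simp add: e_def)
    have "vec.dim W' + Suc k * vec.dim (eigenspace_in A \<nu> W') \<le> CARD('n)" for \<nu>
    proof -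
      have "eigenspace_in A \<nu> W' \<subseteq> eigenspace_in A \<nu> W" using \<open>W' \<subseteq> W\<close> by blast
      then have "vec.dim (eigenspace_in A \<nu> W') \<le> e \<nu>" unfolding e_def by (rule vec.dim_subset)
      then have "Suc k * vec.dim (eigenspace_in A \<nu> W') \<le> Suc k * e \<nu>" by (rule mult_le_mono2)
      \<comment> \<open>The additional copy is paid for by the drop in rank, which is
        \<open>e \<mu>\<close> and by maximality at least \<open>e \<nu>\<close>.\<close>
      also have "\<dots> \<le> e \<mu> + k * e \<nu>" using \<mu>[of \<nu>] by simp
      finally show ?thesis
        using P[unfolded P_def, folded W_def, folded e_def] dims
        by (auto dest!: spec[where x = \<nu>])
    qed
    moreover have "A ** (?N ** M) = (?N ** M) ** A"
      using P by (intro matrix_commute_mult) (simp_all add: P_def shift_mult)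
    ultimately have "P (Suc k) (?N ** M)"
      unfolding P_def W'_def by blast
    then show "\<exists>M'. P (Suc k) M' \<and> (\<exists>\<mu>. M' = (A - mat \<mu>) ** M)" by blast
  qed
  then obtain Q where Q: "\<And>k. P k (Q k)" "\<And>k. \<exists>\<mu>. Q (Suc k) = (A - mat \<mu>) ** Q k"
    by blast
  have "Q 0 = mat 1" using Q(1)[of 0] by (simp add: P_def)
  moreover have "Suc k * vec.dim (eigenspace_in A \<mu> (range ((*v) (Q k)))) \<le> CARD('n)" for k \<mu>
  proof -
    let ?W = "range ((*v) (Q k))"
    have "vec.dim (eigenspace_in A \<mu> ?W) \<le> vec.dim ?W" by (rule vec.dim_subset) auto
    moreover have "vec.dim ?W + k * vec.dim (eigenspace_in A \<mu> ?W) \<le> CARD('n)"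
      using Q(1)[of k] by (simp add: P_def)
    ultimately show ?thesis by simp
  qed
  ultimately show ?thesis using Q(2) by blast
qed

lemma shift_product_commute:
  fixes A :: "complex^'n^'n"
  assumes "Q 0 = mat 1" and step: "\<And>k. \<exists>\<mu>. Q (Suc k) = (A - mat \<mu>) ** Q k"
    and g: "g ** A = A ** g"
  shows "g ** Q k = Q k ** g"
proof (induction k)
  case (Suc k)
  obtain \<mu> where Q: "Q (Suc k) = (A - mat \<mu>) ** Q k" using step by blast
  have "g ** (A - mat \<mu>) = (A - mat \<mu>) ** g" using g by (simp add: shift_mult)
  then show ?case unfolding Q using Suc by (rule matrix_commute_mult)
qed (simp add: assms)

text \<open>By rank-nullity the dimension sought is the codimension in \<open>F\<close> of the
  matrices killed by \<open>Q k\<close>. As \<open>Q k\<close> commutes with \<open>F\<close>, these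
  are the matrices vanishing on its range, and \<open>dim_centralizer_le\<close> bounds that
  codimension.\<close>

lemma dim_ideal_le:
  fixes A :: "complex^'n^'n"
  assumes Q: "Q 0 = mat 1" "\<And>k. \<exists>\<mu>. Q (Suc k) = (A - mat \<mu>) ** Q k"
    and eig: "\<And>\<mu>. Suc k * vec.dim (eigenspace_in A \<mu> (range ((*v) (Q k)))) \<le> CARD('n)"
    and F: "cmat.subspace F" and comm: "\<And>g. g \<in> F \<Longrightarrow> g ** A = A ** g"
  shows "Suc k * cmat.dim ((**) (Q k) ` F) \<le> CARD('n)\<^sup>2"
proof -
  let ?W = "range ((*v) (Q k))"
  \<comment> \<open>Rounding down is harmless, because the eigenspace dimensions bounded by
    \<open>s\<close> are integers.\<close>
  define s where "s = CARD('n) div Suc k"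
  have QW: "g *v (Q k *v x) \<in> ?W" if "g ** A = A ** g" for g x
    using shift_product_commute[OF Q that, of k] by (metis matrix_vector_mul_assoc rangeI)
  have "cmat.dim F \<le> s * vec.dim ?W + cmat.dim {g \<in> F. \<forall>w\<in>?W. g *v w = 0}"
  proof (rule dim_centralizer_le)
    show "vec.subspace ?W" by (intro vec.subspace_image vec.subspace_UNIV)
    show "A *v w \<in> ?W" if "w \<in> ?W" for w using that QW[of A] by auto
    show "g *v w \<in> ?W" if "g \<in> F" "w \<in> ?W" for g w using that QW[OF comm] by auto
    show "vec.dim (eigenspace_in A \<mu> ?W) \<le> s" for \<mu>
      using eig[of \<mu>] by (simp only: s_def less_eq_div_iff_mult_less_eq mult.commute zero_less_Suc)
  qed (use F comm in auto)
  also have "{g \<in> F. \<forall>w\<in>?W. g *v w = 0} = {g \<in> F. Q k ** g = 0}"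
    using shift_product_commute[OF Q comm, of _ k]
    by (auto simp: matrix_eq[of _ 0] matrix_vector_mul_assoc)
  finally have "cmat.dim ((**) (Q k) ` F) \<le> s * vec.dim ?W"
    using cmat_pair.dim_image_plus_dim_kernel[OF linear_matrix_mult F, of "Q k"] by linarith
  also have "\<dots> \<le> s * CARD('n)" by (simp add: dim_subset_UNIV_cart_gen)
  finally have "Suc k * cmat.dim ((**) (Q k) ` F) \<le> Suc k * s * CARD('n)"
    by (metis mult.assoc mult_le_mono2)
  also have "\<dots> \<le> CARD('n) * CARD('n)"
    unfolding s_def by (intro mult_le_mono1) (rule times_div_less_eq_dividend)
  finally show ?thesis by (simp add: power2_eq_square)
qed

section \<open>The generated algebra\<close>

lemma is_subalgebra_generated_algebra: "is_subalgebra (generated_algebra G)"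
  unfolding generated_algebra_def
  by (rule hull_in) (auto simp: is_subalgebra_def cmat.subspace_def)

text \<open>The centralizer of \<open>M\<close> is a subalgebra.\<close>

lemma generated_algebra_commute:
  assumes "\<And>N. N \<in> G \<Longrightarrow> N ** M = M ** N" and "N \<in> generated_algebra G"
  shows "N ** M = M ** N"
proof -
  have "is_subalgebra {N. N ** M = M ** N}"
    by (auto simp: is_subalgebra_def cmat.subspace_def matrix_add_ldistrib matrix_add_rdistrib
        scale_mat_mult_left scale_mat_mult_right) (metis matrix_mul_assoc)
  then have "generated_algebra G \<subseteq> {N. N ** M = M ** N}"
    unfolding generated_algebra_def using assms(1) by (intro hull_minimal) auto
  with assms(2) show ?thesis by blast
qed

text \<open>The matrices whose left multiplication preserves the span form a subalgebra containing
  \<open>G\<close>; applying its elements to \<open>mat 1\<close> gives the inclusion. The span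
  itself need not be closed under products.\<close>

lemma generated_algebra_le_span:
  fixes G T :: "(complex^'n^'n) set"
  assumes "mat 1 \<in> cmat.span T" and "\<And>M t. M \<in> G \<Longrightarrow> t \<in> T \<Longrightarrow> M ** t \<in> cmat.span T"
  shows "generated_algebra G \<subseteq> cmat.span T"
proof -
  let ?S = "{M. \<forall>t\<in>cmat.span T. M ** t \<in> cmat.span T}"
  have "is_subalgebra ?S"
    by (auto simp: is_subalgebra_def cmat.subspace_def matrix_add_rdistrib scale_mat_mult_left
        cmat.span_add cmat.span_scale cmat.span_zero simp flip: matrix_mul_assoc)
  moreover have "G \<subseteq> ?S"
  proof clarify
    fix M t assume "M \<in> G" "t \<in> cmat.span T"
    have "cmat.subspace {t. M ** t \<in> cmat.span T}"
      by (auto simp: cmat.subspace_def matrix_add_ldistrib scale_mat_mult_right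
          cmat.span_add cmat.span_scale cmat.span_zero)
    with \<open>t \<in> cmat.span T\<close> show "M ** t \<in> cmat.span T"
      using cmat.span_induct[of t T "\<lambda>t. M ** t \<in> cmat.span T"] assms(2)[OF \<open>M \<in> G\<close>] by blast
  qed
  ultimately have "generated_algebra G \<subseteq> ?S"
    unfolding generated_algebra_def by (intro hull_minimal)
  then show ?thesis using assms(1) by force
qed

section \<open>Spanning the algebra modulo the ideals\<close>

text \<open>Monomials in \<open>A 1\<close>, ..., \<open>A m\<close> with all exponents below
  \<open>k\<close>, where the shift product \<open>Q i a\<close>, monic of degree \<open>a\<close>
  in \<open>A i\<close>, replaces the power of exponent \<open>a\<close>.\<close>

primrec shift_monomials ::
    "(nat \<Rightarrow> nat \<Rightarrow> complex^'n^'n) \<Rightarrow> nat \<Rightarrow> nat \<Rightarrow> (complex^'n^'n) set" where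
  "shift_monomials Q k 0 = {mat 1}"
| "shift_monomials Q k (Suc m) = (\<lambda>(a, t). Q (Suc m) a ** t) ` ({..<k} \<times> shift_monomials Q k m)"

lemma card_shift_monomials: "finite (shift_monomials Q k m) \<and> card (shift_monomials Q k m) \<le> k ^ m"
proof (induction m)
  case (Suc m)
  then have "card (shift_monomials Q k (Suc m)) \<le> card ({..<k} \<times> shift_monomials Q k m)"
    by (simp only: shift_monomials.simps) (intro card_image_le, simp)
  with Suc show ?case by (auto simp: card_cartesian_product intro: order_trans mult_le_mono2)
qed simp

text \<open>Multiplication by \<open>A i\<close> raises the exponent of the factor
  \<open>Q i a\<close> by one, up to a multiple of the same monomial. An exponent reaching
  \<open>k\<close> puts the product into the ideal of \<open>Q i k\<close>. So the monomials and the
  ideals together span a space that contains \<open>mat 1\<close> and is stable under the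
  generators.\<close>

lemma dim_generated_algebra_le:
  fixes A :: "nat \<Rightarrow> complex^'n^'n"
  assumes commuting: "\<And>i j. i \<in> {1..l} \<Longrightarrow> j \<in> {1..l} \<Longrightarrow> A i ** A j = A j ** A i"
    and F: "F = generated_algebra (insert (mat 1) (A ` {1..l}))"
    and Q: "\<And>i. Q i 0 = mat 1" "\<And>i k. \<exists>\<mu>. Q i (Suc k) = (A i - mat \<mu>) ** Q i k"
    and "0 < k"
  shows "cmat.dim F \<le> k ^ l + (\<Sum>i\<in>{1..l}. cmat.dim ((**) (Q i k) ` F))"
proof -
  have sub: "cmat.subspace F" and mult: "\<And>M N. M \<in> F \<Longrightarrow> N \<in> F \<Longrightarrow> M ** N \<in> F"
    using is_subalgebra_generated_algebra unfolding F is_subalgebra_def by auto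
  have gen: "mat 1 \<in> F" "\<And>i. i \<in> {1..l} \<Longrightarrow> A i \<in> F"
    unfolding F generated_algebra_def by (auto intro: hull_inc)
  have comm: "g ** A i = A i ** g" if "g \<in> F" "i \<in> {1..l}" for g i
  proof (rule generated_algebra_commute)
    show "N ** A i = A i ** N" if "N \<in> insert (mat 1) (A ` {1..l})" for N
      using that commuting \<open>i \<in> {1..l}\<close> by auto
  qed (use that F in simp)
  have QF: "Q i a \<in> F" if "i \<in> {1..l}" for i a
  proof (induction a)
    case (Suc a)
    obtain \<mu> where "Q i (Suc a) = (A i - mat \<mu>) ** Q i a" using Q(2) by blast
    then show ?case
      using Suc gen(2)[OF that] sub mult by (simp add: shift_mult cmat.subspace_diff cmat.subspace_scale)
  qed (simp add: Q gen)
  have Qcomm: "g ** Q i a = Q i a ** g" if "g \<in> F" "i \<in> {1..l}" for g i a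
    using shift_product_commute[OF Q] comm that by blast
  \<comment> \<open>A plain union of the ideals; their sum only enters through the span.\<close>
  define J where "J = (\<Union>i\<in>{1..l}. (**) (Q i k) ` F)"
  let ?T = "\<lambda>m. shift_monomials Q k m \<union> J"
  have TF: "shift_monomials Q k m \<subseteq> F" if "m \<le> l" for m
    using that by (induction m) (auto intro!: mult QF gen)
  have J: "M ** t \<in> J" if "M \<in> F" "t \<in> J" for M t
  proof -
    obtain i f where "i \<in> {1..l}" "f \<in> F" "t = Q i k ** f" using \<open>t \<in> J\<close> unfolding J_def by blast
    moreover from this have "M ** t = Q i k ** (M ** f)"
      using Qcomm[OF \<open>M \<in> F\<close>, of i k] by (simp add: matrix_mul_assoc)
    ultimately show ?thesis using mult[OF \<open>M \<in> F\<close>] unfolding J_def by blast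
  qed
  have closed: "A i ** t \<in> cmat.span (?T m)"
    if "m \<le> l" "i \<in> {1..m}" "t \<in> shift_monomials Q k m" for m i t
    using that
  proof (induction m arbitrary: t)
    case (Suc m)
    then obtain a t' where t: "t = Q (Suc m) a ** t'" "a < k" "t' \<in> shift_monomials Q k m"
      by auto
    have m: "Suc m \<in> {1..l}" and i: "i \<in> {1..l}" using Suc.prems by auto
    show ?case
    proof (cases "i = Suc m")
      case True
      obtain \<mu> where "Q i (Suc a) = A i ** Q i a - scale_mat \<mu> (Q i a)"
        using Q(2) shift_mult(1) by metis
      then have "A i ** t = Q i (Suc a) ** t' + scale_mat \<mu> t"
        using True t
        by (simp add: matrix_diff_rdistrib scale_mat_mult_left matrix_mul_assoc)
      \<comment> \<open>Either the raised exponent is still admissible, or it equals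
        \<open>k\<close> and the product lies in \<open>J\<close>.\<close>
      moreover have "Q i (Suc a) ** t' \<in> ?T (Suc m)"
      proof (cases "Suc a < k")
        case False
        then have "Suc a = k" using t by simp
        then show ?thesis using TF[of m] t(3) i m True unfolding J_def by force
      next
        case a: True
        then show ?thesis using True t by force
      qed
      moreover have "t \<in> ?T (Suc m)" using Suc.prems by simp
      ultimately show ?thesis
        by (simp add: cmat.span_add cmat.span_scale cmat.span_base)
    next
      case False
      \<comment> \<open>Here \<open>A i\<close> passes the outermost factor, which then maps the
        span for \<open>m\<close> into that for \<open>Suc m\<close>.\<close>
      have "A i ** t' \<in> cmat.span (?T m)"
        using Suc False t by simp
      then have "Q (Suc m) a ** (A i ** t') \<in> cmat.span ((**) (Q (Suc m) a) ` ?T m)"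
        using module_hom.span_image[OF Vector_Spaces.linear.axioms(3)[OF linear_matrix_mult]] by blast
      moreover have "(**) (Q (Suc m) a) ` ?T m \<subseteq> ?T (Suc m)"
        using J[OF QF[OF m]] \<open>a < k\<close> by force
      ultimately have "Q (Suc m) a ** (A i ** t') \<in> cmat.span (?T (Suc m))"
        using cmat.span_mono by blast
      moreover have "A i ** t = Q (Suc m) a ** (A i ** t')"
        using Qcomm[OF gen(2)[OF i] m, of a] t by (simp add: matrix_mul_assoc)
      ultimately show ?thesis by simp
    qed
  qed simp
  have one: "mat 1 \<in> shift_monomials Q k m" for m
  proof (induction m)
    case (Suc m)
    then have "(0, mat 1) \<in> {..<k} \<times> shift_monomials Q k m" using \<open>0 < k\<close> by simp
    then have "Q (Suc m) 0 ** mat 1 \<in> shift_monomials Q k (Suc m)"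
      unfolding shift_monomials.simps by (rule rev_image_eqI) simp
    then show ?case by (simp add: Q(1))
  qed simp
  have "F \<subseteq> cmat.span (?T l)"
    unfolding F
  proof (rule generated_algebra_le_span)
    show "mat 1 \<in> cmat.span (?T l)" using one by (auto intro: cmat.span_base)
    fix M t assume "M \<in> insert (mat 1) (A ` {1..l})" "t \<in> ?T l"
    then show "M ** t \<in> cmat.span (?T l)"
      using closed[of l] J gen by (auto intro: cmat.span_base)
  qed
  moreover
  \<comment> \<open>To count, each ideal is replaced by a basis, which makes the spanning set
    finite.\<close>
  obtain B where B: "\<And>i. B i \<subseteq> (**) (Q i k) ` F" "\<And>i. cmat.independent (B i)"
    "\<And>i. (**) (Q i k) ` F \<subseteq> cmat.span (B i)" "\<And>i. card (B i) = cmat.dim ((**) (Q i k) ` F)"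
  proof -
    have "\<forall>i. \<exists>B. B \<subseteq> (**) (Q i k) ` F \<and> cmat.independent B \<and>
      (**) (Q i k) ` F \<subseteq> cmat.span B \<and> card B = cmat.dim ((**) (Q i k) ` F)"
      using cmat.basis_exists by metis
    then show ?thesis using that by metis
  qed
  let ?U = "shift_monomials Q k l \<union> (\<Union>i\<in>{1..l}. B i)"
  have "J \<subseteq> cmat.span ?U"
    unfolding J_def using B(3) cmat.span_mono[of "B _" ?U] by blast
  then have "?T l \<subseteq> cmat.span ?U" using cmat.span_superset[of ?U] by blast
  ultimately have "F \<subseteq> cmat.span ?U"
    using cmat.span_minimal[OF _ cmat.subspace_span] by blast
  moreover have fin: "finite ?U"
    using card_shift_monomials B(2) cmat.finiteI_independent by blast
  ultimately have "cmat.dim F \<le> card ?U" by (rule cmat.dim_le_card)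
  also have "\<dots> \<le> card (shift_monomials Q k l) + card (\<Union>i\<in>{1..l}. B i)"
    by (rule card_Un_le)
  also have "\<dots> \<le> k ^ l + (\<Sum>i\<in>{1..l}. card (B i))"
    using card_shift_monomials by (intro add_mono card_UN_le) auto
  finally show ?thesis unfolding B(4) .
qed

section \<open>Choice of the cutoff \<open>k\<close> and the final estimate\<close>

theorem lemma3:
  fixes l :: nat
    and A :: "nat \<Rightarrow> complex^'n^'n"
    and F :: "(complex^'n^'n) set"
  assumes commuting: "\<And>i j. i \<in> {1..l} \<Longrightarrow> j \<in> {1..l} \<Longrightarrow> A i ** A j = A j ** A i"
    and F: "F = generated_algebra (insert (mat 1) (A ` {1..l}))"
  shows "real (cmat.dim F) \<le> (real l + 1) * real CARD('n) powr (2 - 2 / (real l + 1))"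
proof -
  define n where "n = real CARD('n)"
  define e where "e = 2 / (real l + 1)"
  \<comment> \<open>This \<open>k\<close> balances the two contributions. From
    \<open>k \<le> n powr e\<close> and \<open>e * (l + 1) = 2\<close> the monomials number at most
    \<open>n powr (2 - e)\<close>; from \<open>n powr e \<le> k + 1\<close> each of the
    \<open>l\<close> ideals has dimension at most \<open>n powr (2 - e)\<close>. That makes
    \<open>l + 1\<close> equal bounds.\<close>
  define k where "k = nat \<lfloor>n powr e\<rfloor>"
  have n: "n \<ge> 1" by (simp add: n_def Suc_le_eq)
  have "n powr e \<ge> 1" using n by (simp add: e_def ge_one_powr_ge_zero)
  then have k: "0 < k" "real k \<le> n powr e" "n powr e \<le> real (Suc k)"
    unfolding k_def by linarith+
  define P where "P i Q \<longleftrightarrow> Q 0 = mat 1 \<and> (\<forall>k. \<exists>\<mu>. Q (Suc k) = (A i - mat \<mu>) ** Q k) \<and>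
    (\<forall>k \<mu>. Suc k * vec.dim (eigenspace_in (A i) \<mu> (range ((*v) (Q k)))) \<le> CARD('n))" for i Q
  have "\<forall>i. \<exists>Q. P i Q" unfolding P_def by (intro allI greedy_shift_products)
  then obtain Q where "\<And>i. P i (Q i)" by metis
  then have Q: "\<And>i. Q i 0 = mat 1" "\<And>i k. \<exists>\<mu>. Q i (Suc k) = (A i - mat \<mu>) ** Q i k"
    "\<And>i k \<mu>. Suc k * vec.dim (eigenspace_in (A i) \<mu> (range ((*v) (Q i k)))) \<le> CARD('n)"
    unfolding P_def by blast+
  have ideal: "real (cmat.dim ((**) (Q i k) ` F)) \<le> n powr (2 - e)" if "i \<in> {1..l}" for i
  proof -
    have "g ** A i = A i ** g" if "g \<in> F" for g
    proof (rule generated_algebra_commute)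
      show "N ** A i = A i ** N" if "N \<in> insert (mat 1) (A ` {1..l})" for N
        using that commuting \<open>i \<in> {1..l}\<close> by auto
    qed (use that F in simp)
    moreover have "cmat.subspace F"
      using is_subalgebra_generated_algebra unfolding F is_subalgebra_def by blast
    ultimately have "Suc k * cmat.dim ((**) (Q i k) ` F) \<le> CARD('n)\<^sup>2"
      by (intro dim_ideal_le[where A = "A i"] Q) auto
    then have "real (Suc k) * real (cmat.dim ((**) (Q i k) ` F)) \<le> n\<^sup>2"
      unfolding n_def by (metis of_nat_le_iff of_nat_mult of_nat_power)
    then have "n powr e * real (cmat.dim ((**) (Q i k) ` F)) \<le> n\<^sup>2"
      using mult_right_mono[OF k(3), of "real (cmat.dim ((**) (Q i k) ` F))"] by linarith
    also have "n\<^sup>2 = n powr e * n powr (2 - e)"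
      using n by (simp flip: powr_add)
    finally show ?thesis using n by simp
  qed
  have "real k ^ l \<le> (n powr e) ^ l"
    using k by (intro power_mono) auto
  also have "\<dots> = n powr (2 - e)"
    using n by (simp add: e_def powr_power field_simps)
  finally have "real (k ^ l) \<le> n powr (2 - e)" by simp
  moreover have "real (\<Sum>i\<in>{1..l}. cmat.dim ((**) (Q i k) ` F)) \<le> real l * n powr (2 - e)"
    using sum_mono[of "{1..l}", OF ideal] by simp
  moreover have "real (cmat.dim F) \<le> real (k ^ l) + real (\<Sum>i\<in>{1..l}. cmat.dim ((**) (Q i k) ` F))"
    using dim_generated_algebra_le[OF commuting F Q(1,2) k(1)] by (metis of_nat_add of_nat_le_iff)
  ultimately show ?thesis by (simp add: n_def e_def algebra_simps)
qed

end
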